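(* Let $S_\ell\in\mathbb{R}^{\ell\times m}$ be a random matrix with i.i.d. random rows $s_1,\dots,s_\ell\in\mathbb{R}^m$, and let $$Z_1=(s_1^{\mathsf T}AB^{-1/2}P)^\dagger s_1^{\mathsf T}AB^{-1/2}P$$ be the orthogonal projector onto $\operatorname{range}(PB^{-1/2}A^{\mathsf T}s_1)$, where $P=I-(QAB^{-1/2})^\dagger QAB^{-1/2}$. Assume that $\operatorname{null}(\mathbb{E}[Z_1])=\operatorname{null}(AB^{-1/2}P)$. If $\{x^k\}_{k\ge0}$ are the subspace-constrained sketch-and-project iterates for the consistent system $Ax=b$ with sketching matrix $S_\ell$ (an independent copy of $S_\ell$ being drawn in each iteration), then for all $k$ $$\mathbb{E}\|x^k-x^*\|_B^2\le\bigl(1-\lambda_{\min}^+(\mathbb{E}[Z_1])\bigr)^{\ell k}\,\|x^0-x^*\|_B^2.$$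
   Context: Setting: $A\in\mathbb{R}^{m\times n}$, $b\in\mathbb{R}^m$ with $Ax=b$ consistent; $B\in\mathbb{R}^{n\times n}$ is symmetric positive definite with $\|x\|_B=\sqrt{x^{\mathsf T}Bx}$; $Q\in\mathbb{R}^{d\times m}$ with $d<m$ is a fixed matrix. $M^\dagger$ is the Moore–Penrose pseudoinverse; $\lambda_{\min}^+$ is the smallest non-zero eigenvalue. Subspace-constrained sketch-and-project: $x^0\in\mathbb{R}^n$ is any vector with $QAx^0=Qb$, and $$x^{k+1}=\operatorname*{arg\,min}_{x\in\mathbb{R}^n}\|x-x^k\|_B\quad\text{such that}\quad SAx=Sb,\ QAx=Qb,$$ where the sketching matrix $S=S^k$ is drawn independently at each iteration from the given distribution. The target solution is $x^*:=\operatorname*{arg\,min}_{x}\|x-x^0\|_B$ subject to $Ax=b$. *)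

theory Defs
  imports "HOL-Probability.Probability"
begin

definition sym_posdef :: "real^'n^'n \<Rightarrow> bool" where
  "sym_posdef B \<longleftrightarrow> transpose B = B \<and> (\<forall>x. x \<noteq> 0 \<longrightarrow> 0 < x \<bullet> (B *v x))"

(* The principal square root, i.e. the unique symmetric positive definite one;
   meaningful for symmetric positive definite B. *)
definition spd_sqrt :: "real^'n^'n \<Rightarrow> real^'n^'n" where
  "spd_sqrt B = (THE C. sym_posdef C \<and> C ** C = B)"

definition inv_sqrt :: "real^'n^'n \<Rightarrow> real^'n^'n" where
  "inv_sqrt B = matrix_inv (spd_sqrt B)"

definition weighted_norm :: "real^'n^'n \<Rightarrow> real^'n \<Rightarrow> real" where
  "weighted_norm B x = sqrt (x \<bullet> (B *v x))"

(* Moore--Penrose pseudoinverse, characterised by the four Penrose equations,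
   which have exactly one solution for every real matrix. *)
definition pinv :: "real^'n^'m \<Rightarrow> real^'m^'n" where
  "pinv M = (THE X. M ** X ** M = M \<and> X ** M ** X = X \<and>
                    transpose (M ** X) = M ** X \<and> transpose (X ** M) = X ** M)"

definition null_space :: "real^'n^'m \<Rightarrow> (real^'n) set" where
  "null_space M = {v. M *v v = 0}"

definition eigenvalues :: "real^'n^'n \<Rightarrow> real set" where
  "eigenvalues M = {c. \<exists>v. v \<noteq> 0 \<and> M *v v = c *\<^sub>R v}"

(* The smallest non-zero eigenvalue; unspecified (Min of the empty set) if all
   eigenvalues are zero. *)
definition lambda_min_pos :: "real^'n^'n \<Rightarrow> real" where
  "lambda_min_pos M = Min (eigenvalues M - {0})"

definition constraint_proj :: "real^'n^'m \<Rightarrow> real^'n^'n \<Rightarrow> real^'m^'d \<Rightarrow> real^'n^'n" where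
  "constraint_proj A B Q = mat 1 - pinv (Q ** A ** inv_sqrt B) ** (Q ** A ** inv_sqrt B)"

(* rowvector s, a matrix with a single row, is the transpose of the column vector s. *)
definition row_proj ::
  "real^'n^'m \<Rightarrow> real^'n^'n \<Rightarrow> real^'m^'d \<Rightarrow> real^'m \<Rightarrow> real^'n^'n" where
  "row_proj A B Q s =
     (let R = (rowvector s :: real^'m^1) ** A ** inv_sqrt B ** constraint_proj A B Q
      in pinv R ** R)"

(* Iterates for a given sequence S of sketching matrices. For symmetric positive
   definite B, each minimiser exists and is unique whenever A x = b is consistent. *)
primrec scsp_iterate ::
  "real^'n^'m \<Rightarrow> real^'m \<Rightarrow> real^'n^'n \<Rightarrow> real^'m^'d \<Rightarrow> real^'n \<Rightarrow>
   (nat \<Rightarrow> real^'m^'l) \<Rightarrow> nat \<Rightarrow> real^'n" where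
  "scsp_iterate A b B Q x0 S 0 = x0"
| "scsp_iterate A b B Q x0 S (Suc k) =
     arg_min (\<lambda>x. weighted_norm B (x - scsp_iterate A b B Q x0 S k))
             (\<lambda>x. (S k ** A) *v x = S k *v b \<and> (Q ** A) *v x = Q *v b)"

definition target_solution ::
  "real^'n^'m \<Rightarrow> real^'m \<Rightarrow> real^'n^'n \<Rightarrow> real^'n \<Rightarrow> real^'n" where
  "target_solution A b B x0 = arg_min (\<lambda>x. weighted_norm B (x - x0)) (\<lambda>x. A *v x = b)"

end

theory Submission
  imports Defs
begin

text \<open>
  Let \<open>C\<close> be the square root of \<open>B\<close> and measure errors by \<open>y = C (x - x*)\<close>, which turns the weighted norm
  into the Euclidean one. In these coordinates a step of the method is the orthogonal projection of \<open>y\<close> to the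
  complement of the span of the vectors \<open>g = P C\<^sup>-\<^sup>1 A\<^sup>T s\<close>, one for each row \<open>s\<close> of the sketch
  (\<open>sketch_step\<close>), and \<open>Z\<^sub>1\<close> is the projector onto the line of one such vector
  (\<open>row_proj_eq_line_projector\<close>).

  Projecting away a whole span shortens a vector at least as much as removing the components along the
  individual vectors one after the other (\<open>norm_orth_remainder_le_sweep\<close>). In such a sweep the vectors are
  independent and identically distributed, and removing one of them multiplies the mean square norm by at
  most \<open>1 - \<lambda>\<close>, where \<open>\<lambda>\<close> is the smallest non-zero eigenvalue of \<open>E[Z\<^sub>1]\<close>, provided that \<open>y\<close> is orthogonal
  to the kernel of \<open>E[Z\<^sub>1]\<close> (\<open>expected_norm_remove_component\<close>). The hypothesis on kernels ensures the
  latter: all the vectors \<open>g\<close> are orthogonal to the kernel of \<open>A C\<^sup>-\<^sup>1 P\<close>, and so is the initial error,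
  because \<open>x*\<close> is the solution nearest to \<open>x\<^sup>0\<close> (\<open>target_solution_residual\<close>). Independence then gives one factor
  for each row and each iteration (\<open>expected_norm_after_independent_contractions\<close>).

  Two prerequisites are built from the spectral theorem for real symmetric matrices, which in turn follows
  from minimising a quadratic form over a sphere: the principal square root and the Moore--Penrose
  pseudoinverse, which are defined by descriptions and so mean something only after existence and
  uniqueness are known.
\<close>

section \<open>Symmetric matrices\<close>

\<comment> \<open>This simplification rule would replace transposed products by vector-matrix products throughout.\<close>
declare transpose_matrix_vector [simp del]

lemma inner_matrix_vector: "(M *v x) \<bullet> y = x \<bullet> (transpose M *v y)" for M :: "real^'n^'m"
  by (metis dot_lmul_matrix inner_commute transpose_matrix_vector)

text \<open>
  The quadratic form attains its minimum \<open>\<mu>\<close> over the compact unit sphere of \<open>V\<close>, and the minimiser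
  \<open>v\<close> is an eigenvector: moving away from \<open>v\<close> in the direction \<open>w = M v - \<mu> v\<close>, which stays in \<open>V\<close>,
  changes \<open>y \<bullet> M y - \<mu> |y|\<^sup>2\<close>, whose minimum over \<open>V\<close> is \<open>0\<close>, at the first-order rate \<open>2 |w|\<^sup>2\<close>; hence \<open>w = 0\<close>.
  Working in an invariant subspace serves two purposes: it drives the induction
  for the spectral theorem, and with \<open>V\<close> the orthogonal complement of the kernel it identifies the
  constant in the coercivity bound as a non-zero eigenvalue.
\<close>
lemma symmetric_form_minimiser_is_eigenvector:
  fixes M :: "real^'n^'n"
  assumes sym: "transpose M = M" and V: "subspace V" and nz: "V \<noteq> {0}"
    and inv: "\<And>y. y \<in> V \<Longrightarrow> M *v y \<in> V"
  obtains v where "v \<in> V" "norm v = 1" "M *v v = (v \<bullet> (M *v v)) *\<^sub>R v"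
    "\<And>y. y \<in> V \<Longrightarrow> (v \<bullet> (M *v v)) * (y \<bullet> y) \<le> y \<bullet> (M *v y)"
proof -
  let ?S = "V \<inter> sphere 0 1"
  have comp: "compact ?S"
    using closed_subspace[OF V] by (intro closed_Int_compact) auto
  obtain w where w: "w \<in> V" "w \<noteq> 0" using nz V subspace_0 by blast
  have "w /\<^sub>R norm w \<in> ?S" using w V by (auto simp: subspace_scale)
  then have ne: "?S \<noteq> {}" by blast
  have cont: "continuous_on ?S (\<lambda>y. y \<bullet> (M *v y))"
    by (intro continuous_intros linear_continuous_on linear_conv_bounded_linear[THEN iffD1]
        matrix_vector_mul_linear)
  obtain v where v: "v \<in> ?S" and least: "\<And>y. y \<in> ?S \<Longrightarrow> v \<bullet> (M *v v) \<le> y \<bullet> (M *v y)"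
    using continuous_attains_inf[OF comp ne cont] by blast
  define \<mu> where "\<mu> = v \<bullet> (M *v v)"
  have vv: "v \<bullet> v = 1" using v by (simp add: dot_square_norm)
  have form: "\<mu> * (y \<bullet> y) \<le> y \<bullet> (M *v y)" if "y \<in> V" for y
  proof (cases "y = 0")
    case False
    let ?z = "y /\<^sub>R norm y"
    have "?z \<in> ?S" using that False V by (auto simp: subspace_scale)
    from least[OF this] have "\<mu> \<le> (y \<bullet> (M *v y)) / (norm y)\<^sup>2"
      by (simp add: \<mu>_def matrix_vector_mult_scaleR power2_eq_square divide_simps)
    then show ?thesis using False by (simp add: field_simps dot_square_norm)
  qed simp
  define w where "w = M *v v - \<mu> *\<^sub>R v"
  define q where "q = w \<bullet> (M *v w) - \<mu> * (w \<bullet> w)"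
  have wV: "w \<in> V" unfolding w_def using v inv V by (auto intro: subspace_diff subspace_scale)
  have q0: "0 \<le> q" unfolding q_def using form[OF wV] by simp
  have swap: "v \<bullet> (M *v w) = w \<bullet> (M *v v)"
    by (metis inner_matrix_vector sym inner_commute)
  have ww: "w \<bullet> (M *v v) - \<mu> * (w \<bullet> v) = w \<bullet> w"
    by (simp add: w_def inner_diff_left inner_diff_right inner_commute algebra_simps)
  have quad: "0 \<le> 2 * t * (w \<bullet> w) + t\<^sup>2 * q" for t
  proof -
    have "v + t *\<^sub>R w \<in> V" using v wV V by (auto intro: subspace_add subspace_scale)
    from form[OF this] have "0 \<le> (v + t *\<^sub>R w) \<bullet> (M *v (v + t *\<^sub>R w)) - \<mu> * ((v + t *\<^sub>R w) \<bullet> (v + t *\<^sub>R w))"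
      by simp
    also have "\<dots> = 2 * t * (w \<bullet> (M *v v) - \<mu> * (w \<bullet> v)) + t\<^sup>2 * q"
      using vv by (simp add: q_def matrix_vector_right_distrib matrix_vector_mult_scaleR inner_add_left
          inner_add_right swap inner_commute[of v w] power2_eq_square algebra_simps \<mu>_def[symmetric])
    finally show ?thesis by (simp only: ww)
  qed
  have "w \<bullet> w = 0"
  proof (rule ccontr)
    assume "w \<bullet> w \<noteq> 0"
    then have a: "0 < w \<bullet> w" using inner_ge_zero[of w] by linarith
    \<comment> \<open>A step small enough that the linear term of the quadratic beats its curvature \<open>q\<close>.\<close>
    define t where "t = (w \<bullet> w) / (q + 1)"
    have t: "0 < t" "t * q < w \<bullet> w" using a q0 by (auto simp: t_def field_simps)
    have "t * (2 * (w \<bullet> w) - t * q) \<le> 0"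
      using quad[of "- t"] by (simp add: power2_eq_square algebra_simps)
    with t a show False by (smt (verit) mult_pos_pos)
  qed
  then have "M *v v = \<mu> *\<^sub>R v" by (simp add: w_def)
  then show thesis using that[of v] v form unfolding \<mu>_def by auto
qed

text \<open>
  The spectral theorem, by induction on the dimension: a unit eigenvector is split off and the rest of
  \<open>V\<close> that is orthogonal to it is again invariant.
\<close>
lemma symmetric_invariant_eigenbasis:
  fixes M :: "real^'n^'n"
  assumes sym: "transpose M = M" and "subspace V"
    and "\<And>y. y \<in> V \<Longrightarrow> M *v y \<in> V"
  shows "\<exists>E. finite E \<and> pairwise orthogonal E \<and> span E = V \<and>
           (\<forall>e\<in>E. norm e = 1 \<and> M *v e = (e \<bullet> (M *v e)) *\<^sub>R e)"
  using assms(2,3)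
proof (induction "dim V" arbitrary: V rule: less_induct)
  case less
  show ?case
  proof (cases "V = {0}")
    case True
    then show ?thesis by (intro exI[of _ "{}"]) auto
  next
    case False
    obtain v where v: "v \<in> V" "norm v = 1" "M *v v = (v \<bullet> (M *v v)) *\<^sub>R v"
      using symmetric_form_minimiser_is_eigenvector[OF sym less.prems(1) False less.prems(2)] by metis
    have vv: "v \<bullet> v = 1" using v by (simp add: dot_square_norm)
    define V' where "V' = {y \<in> V. v \<bullet> y = 0}"
    have sub: "subspace V'" using less.prems(1)
      by (auto simp: V'_def subspace_def inner_add_right)
    have "v \<notin> V'" using vv by (simp add: V'_def)
    moreover have "V' \<subseteq> V" by (auto simp: V'_def)
    ultimately have "V' \<subset> V" using v by blast
    then have dim: "dim V' < dim V"
      using sub less.prems(1) by (intro dim_psubset) (simp add: span_eq_iff[THEN iffD2])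
    have "v \<bullet> (M *v y) = 0" if "v \<bullet> y = 0" for y
      using inner_matrix_vector[of M v y] sym v(3) that by (metis inner_scaleR_left mult_zero_right)
    then have inv: "M *v y \<in> V'" if "y \<in> V'" for y
      using that less.prems(2) by (auto simp: V'_def)
    obtain E where E: "finite E" "pairwise orthogonal E" "span E = V'"
      "\<forall>e\<in>E. norm e = 1 \<and> M *v e = (e \<bullet> (M *v e)) *\<^sub>R e"
      using less.hyps[OF dim sub inv] by blast
    have EV': "E \<subseteq> V'" using E(3) span_superset by blast
    have "span (insert v E) = V"
    proof
      show "span (insert v E) \<subseteq> V"
        using EV' v less.prems(1) by (intro span_minimal) (auto simp: V'_def)
      show "V \<subseteq> span (insert v E)"
      proof
        fix y assume y: "y \<in> V"
        have "y - (v \<bullet> y) *\<^sub>R v \<in> V'"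
          using y v vv less.prems(1) by (auto simp: V'_def inner_diff_right intro: subspace_diff subspace_scale)
        then show "y \<in> span (insert v E)" using E(3) by (auto simp: span_insert)
      qed
    qed
    moreover have "pairwise orthogonal (insert v E)"
      using E(2) EV' by (auto simp: pairwise_insert orthogonal_def V'_def inner_commute)
    ultimately show ?thesis using E v by (intro exI[of _ "insert v E"]) auto
  qed
qed

lemma symmetric_eigenbasis:
  fixes M :: "real^'n^'n"
  assumes sym: "transpose M = M"
  obtains E where "finite E" "pairwise orthogonal E" "span E = UNIV"
    "\<And>e. e \<in> E \<Longrightarrow> norm e = 1" "\<And>e. e \<in> E \<Longrightarrow> M *v e = (e \<bullet> (M *v e)) *\<^sub>R e"
  using symmetric_invariant_eigenbasis[OF sym, of UNIV] by auto

lemma matrix_eq_on_span: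
  fixes M N :: "real^'n^'m"
  assumes "span E = UNIV" "\<And>e. e \<in> E \<Longrightarrow> M *v e = N *v e"
  shows "M = N"
proof -
  have "M *v x = N *v x" for x
    using linear_eq_on_span[of "(*v) M" "(*v) N" E x] assms by auto
  then show ?thesis by (simp add: matrix_eq)
qed

text \<open>
  In an orthonormal eigenbasis every real function \<open>f\<close> acts on the eigenvalues, and products of matrices
  become pointwise products of functions. The square root is the case \<open>f = sqrt\<close>; the
  pseudoinverse is the case \<open>f = inverse\<close>, because \<open>inverse 0 = 0\<close> is what a generalised
  inverse does to the kernel.
\<close>
lemma symmetric_functional_calculus:
  fixes M :: "real^'n^'n"
  assumes sym: "transpose M = M"
  obtains F :: "(real \<Rightarrow> real) \<Rightarrow> real^'n^'n" where
    "\<And>f. transpose (F f) = F f"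
    "\<And>f g. F f ** F g = F (\<lambda>t. f t * g t)"
    "F (\<lambda>t. t) = M"
    "\<And>f g. (\<And>c. c \<in> eigenvalues M \<Longrightarrow> f c = g c) \<Longrightarrow> F f = F g"
    "\<And>f x. (\<And>c. c \<in> eigenvalues M \<Longrightarrow> 0 < f c) \<Longrightarrow> x \<noteq> 0 \<Longrightarrow> 0 < x \<bullet> (F f *v x)"
proof -
  obtain E where E: "finite E" "pairwise orthogonal E" "span E = UNIV"
    "\<And>e. e \<in> E \<Longrightarrow> norm e = 1" "\<And>e. e \<in> E \<Longrightarrow> M *v e = (e \<bullet> (M *v e)) *\<^sub>R e"
    using symmetric_eigenbasis[OF sym] by metis
  define l where "l e = e \<bullet> (M *v e)" for e
  define F :: "(real \<Rightarrow> real) \<Rightarrow> real^'n^'n" where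
    "F f = (\<chi> i j. \<Sum>e\<in>E. f (l e) * e$i * e$j)" for f
  have eig: "l e \<in> eigenvalues M" if "e \<in> E" for e
  proof -
    have "e \<noteq> 0" using E(4)[OF that] by auto
    then show ?thesis using E(5)[OF that] by (auto simp: eigenvalues_def l_def)
  qed
  have Fx: "F f *v x = (\<Sum>e\<in>E. (f (l e) * (e \<bullet> x)) *\<^sub>R e)" for f x
    unfolding F_def matrix_vector_mult_def vec_eq_iff inner_vec_def
    by (auto simp: sum_distrib_left sum_distrib_right algebra_simps intro: sum.swap)
  have Fe: "F f *v e = f (l e) *\<^sub>R e" if e: "e \<in> E" for f e
  proof -
    have "d \<bullet> e = (if d = e then 1 else 0)" if "d \<in> E" for d
      using E(2,4) that e by (auto simp: pairwise_def orthogonal_def dot_square_norm)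
    then have "F f *v e = (\<Sum>d\<in>E. if d = e then f (l e) *\<^sub>R e else 0)"
      unfolding Fx by (intro sum.cong) auto
    then show ?thesis using E(1) e by simp
  qed
  show thesis
  proof (rule that[of F])
    show "transpose (F f) = F f" for f
      by (simp add: F_def transpose_def vec_eq_iff mult_ac)
    show "F f ** F g = F (\<lambda>t. f t * g t)" for f g
      by (rule matrix_eq_on_span[OF E(3)])
        (simp add: Fe matrix_vector_mul_assoc[symmetric] matrix_vector_mult_scaleR mult.commute)
    show "F (\<lambda>t. t) = M"
      by (rule matrix_eq_on_span[OF E(3)]) (metis Fe E(5) l_def)
    show "F f = F g" if "\<And>c. c \<in> eigenvalues M \<Longrightarrow> f c = g c" for f g
      using that eig by (simp add: F_def)
    show "0 < x \<bullet> (F f *v x)" if f: "\<And>c. c \<in> eigenvalues M \<Longrightarrow> 0 < f c" and x: "x \<noteq> 0" for f x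
    proof -
      have expand: "x \<bullet> (F f *v x) = (\<Sum>e\<in>E. f (l e) * (e \<bullet> x)\<^sup>2)"
        by (simp add: Fx inner_sum_right power2_eq_square inner_commute mult.assoc)
      have "\<exists>e\<in>E. e \<bullet> x \<noteq> 0"
      proof (rule ccontr)
        assume "\<not> ?thesis"
        then have "orthogonal x x"
          using E(3) by (intro orthogonal_to_span[of x E]) (auto simp: orthogonal_def inner_commute)
        then show False using x by (simp add: orthogonal_def)
      qed
      then show ?thesis unfolding expand
        using E(1) f eig by (auto intro!: sum_pos2 simp: less_imp_le)
    qed
  qed
qed

section \<open>Principal square root and pseudoinverse\<close>

lemma sym_posdef_sqrt_exists:
  fixes B :: "real^'n^'n"
  assumes "sym_posdef B"
  shows "\<exists>C. sym_posdef C \<and> C ** C = B"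
proof -
  have sym: "transpose B = B" and pos: "\<And>x. x \<noteq> 0 \<Longrightarrow> 0 < x \<bullet> (B *v x)"
    using assms by (auto simp: sym_posdef_def)
  have eig: "0 < c" if c: "c \<in> eigenvalues B" for c
  proof -
    obtain v where "v \<noteq> 0" "B *v v = c *\<^sub>R v" using c by (auto simp: eigenvalues_def)
    then have "0 < c * (v \<bullet> v)" "0 < v \<bullet> v" using pos[of v] by auto
    then show ?thesis by (simp add: zero_less_mult_iff)
  qed
  obtain F :: "(real \<Rightarrow> real) \<Rightarrow> real^'n^'n" where F: "\<And>f. transpose (F f) = F f"
    "\<And>f g. F f ** F g = F (\<lambda>t. f t * g t)" "F (\<lambda>t. t) = B"
    "\<And>f g. (\<And>c. c \<in> eigenvalues B \<Longrightarrow> f c = g c) \<Longrightarrow> F f = F g"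
    "\<And>f x. (\<And>c. c \<in> eigenvalues B \<Longrightarrow> 0 < f c) \<Longrightarrow> x \<noteq> 0 \<Longrightarrow> 0 < x \<bullet> (F f *v x)"
    by (rule symmetric_functional_calculus[OF sym]) blast
  have "F sqrt ** F sqrt = F (\<lambda>t. sqrt t * sqrt t)" by (rule F(2))
  also have "\<dots> = F (\<lambda>t. t)" using eig by (intro F(4)) (simp add: less_imp_le)
  also have "\<dots> = B" by (rule F(3))
  finally have "F sqrt ** F sqrt = B" .
  moreover have "sym_posdef (F sqrt)"
    unfolding sym_posdef_def using F(1) F(5)[of sqrt] eig by simp
  ultimately show ?thesis by blast
qed

text \<open>
  On an eigenvector \<open>e\<close> of \<open>D\<close> with eigenvalue \<open>\<mu>\<close>, the vector \<open>u = C e - \<mu> e\<close> satisfies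
  \<open>C u = - \<mu> u\<close>; a positive definite \<open>C\<close> has no negative eigenvalue, so \<open>u = 0\<close>.
\<close>
lemma sym_posdef_sqrt_unique:
  assumes C: "sym_posdef C" and D: "sym_posdef D" and eq: "C ** C = D ** D"
  shows "C = D"
proof -
  have symD: "transpose D = D" using D by (simp add: sym_posdef_def)
  obtain E where E: "span E = UNIV"
    "\<And>e. e \<in> E \<Longrightarrow> norm e = 1" "\<And>e. e \<in> E \<Longrightarrow> D *v e = (e \<bullet> (D *v e)) *\<^sub>R e"
    using symmetric_eigenbasis[OF symD] by metis
  show ?thesis
  proof (rule matrix_eq_on_span[OF E(1)])
    fix e assume e: "e \<in> E"
    define \<mu> where "\<mu> = e \<bullet> (D *v e)"
    have De: "D *v e = \<mu> *\<^sub>R e" using E(3)[OF e] by (simp add: \<mu>_def)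
    have "e \<noteq> 0" using E(2)[OF e] by auto
    then have \<mu>: "0 < \<mu>" using D by (simp add: \<mu>_def sym_posdef_def)
    define u where "u = C *v e - \<mu> *\<^sub>R e"
    have "C *v (C *v e) = D *v (D *v e)" by (simp add: matrix_vector_mul_assoc eq)
    then have "C *v u = - \<mu> *\<^sub>R u"
      by (simp add: u_def matrix_vector_mult_diff_distrib matrix_vector_mult_scaleR De algebra_simps)
    then have "u \<bullet> (C *v u) \<le> 0" using \<mu> by simp
    then have "u = 0" using C unfolding sym_posdef_def by force
    then show "C *v e = D *v e" by (simp add: u_def De)
  qed
qed

lemma spd_sqrt:
  assumes "sym_posdef B"
  shows "sym_posdef (spd_sqrt B)" "spd_sqrt B ** spd_sqrt B = B"
proof -
  have "\<exists>!C. sym_posdef C \<and> C ** C = B"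
    using sym_posdef_sqrt_exists[OF assms] sym_posdef_sqrt_unique by metis
  from theI'[OF this] show "sym_posdef (spd_sqrt B)" "spd_sqrt B ** spd_sqrt B = B"
    by (auto simp: spd_sqrt_def)
qed

lemma inv_sqrt:
  assumes B: "sym_posdef B"
  shows "inv_sqrt B ** spd_sqrt B = mat 1" "spd_sqrt B ** inv_sqrt B = mat 1"
    "transpose (inv_sqrt B) = inv_sqrt B"
proof -
  let ?C = "spd_sqrt B"
  have "x = 0" if "?C *v x = 0" for x
    using spd_sqrt(1)[OF B] that unfolding sym_posdef_def by force
  then have "invertible ?C"
    by (simp add: invertible_left_inverse matrix_left_invertible_ker)
  then have "\<exists>K. ?C ** K = mat 1 \<and> K ** ?C = mat 1" by (simp add: invertible_def)
  from someI_ex[OF this] show inv: "inv_sqrt B ** ?C = mat 1" "?C ** inv_sqrt B = mat 1"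
    by (simp_all add: inv_sqrt_def matrix_inv_def)
  have "transpose (inv_sqrt B) ** ?C = mat 1"
    using inv(2) spd_sqrt(1)[OF B] by (metis matrix_transpose_mul sym_posdef_def transpose_mat)
  then show "transpose (inv_sqrt B) = inv_sqrt B"
    using inv(2) by (metis matrix_mul_assoc[of "transpose (inv_sqrt B)"] matrix_mul_lid matrix_mul_rid)
qed

lemma weighted_norm_conv_norm:
  assumes "sym_posdef B"
  shows "weighted_norm B x = norm (spd_sqrt B *v x)"
proof -
  have "x \<bullet> (B *v x) = (spd_sqrt B *v x) \<bullet> (spd_sqrt B *v x)"
    using spd_sqrt[OF assms] by (metis inner_matrix_vector matrix_vector_mul_assoc sym_posdef_def)
  then show ?thesis by (simp add: weighted_norm_def norm_eq_sqrt_inner)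
qed

text \<open>
  The equations determine both \<open>M X\<close> and \<open>X M\<close> (they are the orthogonal projectors onto the column and the row
  space of \<open>M\<close>), and \<open>X = X M X\<close> can be written with these two alone.
\<close>
lemma penrose_unique:
  fixes M :: "real^'n^'m"
  assumes X: "M ** X ** M = M" "X ** M ** X = X" "transpose (M ** X) = M ** X" "transpose (X ** M) = X ** M"
    and Y: "M ** Y ** M = M" "Y ** M ** Y = Y" "transpose (M ** Y) = M ** Y" "transpose (Y ** M) = Y ** M"
  shows "X = Y"
proof -
  have "M ** X = (M ** Y) ** (M ** X)" by (simp add: matrix_mul_assoc Y(1))
  then have "transpose (M ** X) = transpose ((M ** Y) ** (M ** X))" by simp
  then have MX: "M ** X = M ** Y"
    by (simp add: matrix_transpose_mul[of "M ** Y"] X(3) Y(3)) (simp add: matrix_mul_assoc X(1))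
  have "X ** M = (X ** M) ** (Y ** M)" by (metis matrix_mul_assoc Y(1))
  then have "transpose (X ** M) = transpose ((X ** M) ** (Y ** M))" by simp
  then have XM: "X ** M = Y ** M"
    by (simp add: matrix_transpose_mul[of "X ** M"] X(4) Y(4)) (metis matrix_mul_assoc X(1))
  show ?thesis by (metis MX XM X(2) Y(2) matrix_mul_assoc)
qed

text \<open>
  With \<open>G\<close> the Gram matrix \<open>M\<^sup>T M\<close> and \<open>I\<close> its spectral pseudoinverse, the witness is \<open>I M\<^sup>T\<close>.
  The one step that is not calculus in \<open>G\<close> is \<open>M I G = M\<close>, which holds
  because \<open>M\<close> and \<open>G\<close> have the same kernel.
\<close>
lemma penrose_exists:
  fixes M :: "real^'n^'m"
  shows "\<exists>X. M ** X ** M = M \<and> X ** M ** X = X \<and>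
             transpose (M ** X) = M ** X \<and> transpose (X ** M) = X ** M"
proof -
  define G where "G = transpose M ** M"
  have symG: "transpose G = G" by (simp add: G_def matrix_transpose_mul)
  obtain F :: "(real \<Rightarrow> real) \<Rightarrow> real^'n^'n" where F: "\<And>f. transpose (F f) = F f"
    "\<And>f g. F f ** F g = F (\<lambda>t. f t * g t)" "F (\<lambda>t. t) = G"
    by (rule symmetric_functional_calculus[OF symG]) blast
  define I where "I = F inverse"
  have inv3: "t * inverse t * t = t" "inverse t * t * inverse t = inverse t" for t :: real
    by (cases "t = 0"; simp)+
  have GIG: "G ** I ** G = G"
    unfolding I_def F(3)[symmetric] F(2) by (intro arg_cong[of _ _ F] ext inv3)
  have IGI: "I ** G ** I = I"
    unfolding I_def F(3)[symmetric] F(2) by (intro arg_cong[of _ _ F] ext inv3)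
  have symI: "transpose I = I" by (simp add: I_def F)
  have symIG: "transpose (I ** G) = I ** G"
    unfolding I_def F(3)[symmetric] F(2) by (rule F(1))
  define X where "X = I ** transpose M"
  have XM: "X ** M = I ** G" by (simp add: X_def G_def matrix_mul_assoc)
  have "M *v (I ** G *v x) = M *v x" for x
  proof -
    let ?d = "I ** G *v x - x"
    have "G *v ?d = 0"
      by (simp add: matrix_vector_mult_diff_distrib matrix_vector_mul_assoc GIG matrix_mul_assoc)
    then have "(M *v ?d) \<bullet> (M *v ?d) = 0"
      by (simp add: inner_matrix_vector G_def matrix_vector_mul_assoc)
    then show ?thesis by (simp add: matrix_vector_mult_diff_distrib)
  qed
  then have "M ** (I ** G) = M" by (simp add: matrix_eq matrix_vector_mul_assoc)
  then have 1: "M ** X ** M = M" by (simp add: XM matrix_mul_assoc[symmetric])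
  have 2: "X ** M ** X = X"
    unfolding XM unfolding X_def by (simp add: matrix_mul_assoc IGI)
  have 3: "transpose (M ** X) = M ** X"
    by (simp add: X_def matrix_transpose_mul symI matrix_mul_assoc)
  have 4: "transpose (X ** M) = X ** M" by (simp add: XM symIG)
  show ?thesis using 1 2 3 4 by blast
qed

lemma pinv_penrose:
  fixes M :: "real^'n^'m"
  shows "M ** pinv M ** M = M" "transpose (pinv M ** M) = pinv M ** M"
proof -
  have "\<exists>!X. M ** X ** M = M \<and> X ** M ** X = X \<and>
             transpose (M ** X) = M ** X \<and> transpose (X ** M) = X ** M"
    using penrose_exists[of M] penrose_unique[of M] by (intro ex_ex1I) blast+
  from theI'[OF this] show "M ** pinv M ** M = M" "transpose (pinv M ** M) = pinv M ** M"
    by (auto simp: pinv_def)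
qed

lemma pinv_rowvector:
  fixes r :: "real^'n"
  shows "(pinv (rowvector r :: real^'n^1) ** (rowvector r :: real^'n^1)) *v y = ((r \<bullet> y) / (r \<bullet> r)) *\<^sub>R r"
proof -
  define R where "R = (rowvector r :: real^'n^1)"
  define Z where "Z = pinv R ** R"
  have R: "(R *v x) $ i = r \<bullet> x" for x i
    by (simp add: R_def rowvector_def matrix_vector_mult_def inner_vec_def)
  have Rt: "transpose R *v x = (x $ 1) *\<^sub>R r" for x
    by (simp add: R_def rowvector_def matrix_vector_mult_def transpose_def vec_eq_iff UNIV_1 mult.commute)
  have sym: "transpose Z = Z" unfolding Z_def by (rule pinv_penrose)
  have "Z *v y = transpose R *v (transpose (pinv R) *v y)"
    by (subst sym[symmetric]) (simp add: Z_def matrix_transpose_mul matrix_vector_mul_assoc)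
  then obtain t where t: "Z *v y = t *\<^sub>R r" using Rt by metis
  have "R *v (Z *v y) = R *v y"
    using pinv_penrose(1)[of R] by (simp add: Z_def matrix_vector_mul_assoc matrix_mul_assoc)
  then have "r \<bullet> (Z *v y) = r \<bullet> y" using R by metis
  then have "t * (r \<bullet> r) = r \<bullet> y" by (simp add: t)
  then have "Z *v y = ((r \<bullet> y) / (r \<bullet> r)) *\<^sub>R r" by (cases "r = 0") (auto simp: t eq_divide_eq)
  then show ?thesis by (simp add: Z_def R_def)
qed

text \<open>
  The subtracted matrix is the orthogonal projector onto the row space of \<open>H\<close>, so
  \<open>P\<close> is the orthogonal projector onto the kernel of \<open>H\<close>.
\<close>
lemma pinv_complement_projector:
  fixes H :: "real^'n^'m"
  defines "P \<equiv> mat 1 - pinv H ** H"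
  shows "transpose P = P" "H *v (P *v y) = 0" "H *v y = 0 \<Longrightarrow> P *v y = y"
proof -
  have Py: "P *v y = y - pinv H *v (H *v y)" for y
    by (simp add: P_def matrix_vector_mult_diff_rdistrib matrix_vector_mul_assoc)
  show "transpose P = P"
  proof -
    have "transpose P = transpose (mat 1) - transpose (pinv H ** H)"
      by (simp add: P_def transpose_def vec_eq_iff)
    then show ?thesis by (simp add: P_def pinv_penrose)
  qed
  have "H *v (pinv H *v (H *v y)) = H *v y"
    using pinv_penrose(1)[of H] by (simp add: matrix_vector_mul_assoc matrix_mul_assoc)
  then show "H *v (P *v y) = 0" by (simp add: Py matrix_vector_mult_diff_distrib)
  show "H *v y = 0 \<Longrightarrow> P *v y = y" by (simp add: Py)
qed

section \<open>The smallest non-zero eigenvalue\<close>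

text \<open>
  Needed to know that the minimum defining \<^const>\<open>lambda_min_pos\<close> bounds every non-zero eigenvalue:
  eigenvectors of distinct eigenvalues are orthogonal, hence independent.
\<close>
lemma finite_eigenvalues_symmetric:
  fixes M :: "real^'n^'n"
  assumes sym: "transpose M = M"
  shows "finite (eigenvalues M)"
proof -
  define v where "v c = (SOME v. v \<noteq> 0 \<and> M *v v = c *\<^sub>R v)" for c
  have v: "v c \<noteq> 0" "M *v v c = c *\<^sub>R v c" if "c \<in> eigenvalues M" for c
    using someI_ex[of "\<lambda>v. v \<noteq> 0 \<and> M *v v = c *\<^sub>R v"] that unfolding v_def eigenvalues_def by auto
  have orth: "v c \<bullet> v d = 0" if "c \<in> eigenvalues M" "d \<in> eigenvalues M" "c \<noteq> d" for c d
  proof -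
    have "c * (v c \<bullet> v d) = d * (v c \<bullet> v d)"
      using inner_matrix_vector[of M "v c" "v d"] sym v that by simp
    then show ?thesis using that by simp
  qed
  have inj: "inj_on v (eigenvalues M)"
    by (rule inj_onI) (metis orth v(1) inner_eq_zero_iff)
  have "independent (v ` eigenvalues M)"
  proof (rule pairwise_orthogonal_independent)
    show "pairwise orthogonal (v ` eigenvalues M)"
      using orth unfolding pairwise_def orthogonal_def by blast
    show "0 \<notin> v ` eigenvalues M" using v(1) by force
  qed
  then have "finite (v ` eigenvalues M)" by (rule finiteI_independent)
  then show ?thesis using inj finite_imageD by blast
qed

text \<open>
  On the orthogonal complement of the kernel the form is bounded below by its minimum over the unit
  sphere there. That minimum is an eigenvalue whose eigenvector lies outside the kernel, so it is non-zero.
\<close>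
lemma lambda_min_pos_le_form:
  fixes M :: "real^'n^'n"
  assumes sym: "transpose M = M" and y: "\<And>w. w \<in> null_space M \<Longrightarrow> w \<bullet> y = 0"
  shows "lambda_min_pos M * (y \<bullet> y) \<le> y \<bullet> (M *v y)"
proof (cases "y = 0")
  case False
  define V where "V = {y. \<forall>w\<in>null_space M. w \<bullet> y = 0}"
  have V: "subspace V" by (auto simp: V_def subspace_def inner_add_right)
  have yV: "y \<in> V" using y by (simp add: V_def)
  have inv: "M *v z \<in> V" for z
    using inner_matrix_vector[of M _ z] sym by (simp add: V_def null_space_def) (metis inner_zero_left)
  from yV False have ne: "V \<noteq> {0}" by blast
  obtain v where v: "v \<in> V" "norm v = 1" "M *v v = (v \<bullet> (M *v v)) *\<^sub>R v"
    "\<And>y. y \<in> V \<Longrightarrow> (v \<bullet> (M *v v)) * (y \<bullet> y) \<le> y \<bullet> (M *v y)"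
    using symmetric_form_minimiser_is_eigenvector[OF sym V ne inv] by metis
  let ?\<mu> = "v \<bullet> (M *v v)"
  have v0: "v \<noteq> 0" using v(2) by auto
  have "v \<notin> null_space M" using v(1) v0 unfolding V_def by force
  then have "?\<mu> \<noteq> 0" using v(3) by (force simp: null_space_def)
  then have "?\<mu> \<in> eigenvalues M - {0}" using v(3) v0 by (auto simp: eigenvalues_def)
  then have "lambda_min_pos M \<le> ?\<mu>"
    unfolding lambda_min_pos_def using finite_eigenvalues_symmetric[OF sym] by (intro Min_le) auto
  then have "lambda_min_pos M * (y \<bullet> y) \<le> ?\<mu> * (y \<bullet> y)" by (simp add: mult_right_mono)
  then show ?thesis using v(4)[OF yV] by linarith
qed simp

section \<open>Removing components: one at a time and jointly\<close>

definition remove_component :: "'a::real_inner \<Rightarrow> 'a \<Rightarrow> 'a" where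
  "remove_component r y = y - ((r \<bullet> y) / (r \<bullet> r)) *\<^sub>R r"

text \<open>
  The subtracted number is the quadratic form of the rank-one projector onto the line of \<open>r\<close>; this is
  how the expectation of that projector enters the rate.
\<close>
lemma norm_remove_component:
  "(norm (remove_component r y))\<^sup>2 = (norm y)\<^sup>2 - y \<bullet> (((r \<bullet> y) / (r \<bullet> r)) *\<^sub>R r)"
proof (cases "r = 0")
  case False
  define t where "t = (r \<bullet> y) / (r \<bullet> r)"
  have t: "t * (r \<bullet> r) = r \<bullet> y" using False by (simp add: t_def)
  have "(norm (remove_component r y))\<^sup>2 = (norm y)\<^sup>2 - 2 * t * (r \<bullet> y) + t * (t * (r \<bullet> r))"
    by (simp add: remove_component_def t_def[symmetric] power2_norm_eq_inner inner_diff_left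
        inner_diff_right inner_commute algebra_simps)
  then show ?thesis by (simp add: t t_def[symmetric] inner_commute)
qed (simp add: remove_component_def)

lemma inner_remove_component: "r \<bullet> remove_component r y = 0"
  by (simp add: remove_component_def inner_diff_right)

text \<open>
  The orthogonal projection of \<open>y\<close> to the complement of the span of a list, written as Gram--Schmidt.
  The point of the recursion is that it uses only arithmetic, so the result is a
  measurable function of the list entries, also where they become linearly dependent: a remainder
  that vanishes is divided by zero, and \<^const>\<open>remove_component\<close> then changes nothing.
\<close>
primrec orth_remainder :: "'a::real_inner list \<Rightarrow> 'a \<Rightarrow> 'a" where
  "orth_remainder [] y = y"
| "orth_remainder (r # rs) y = remove_component (orth_remainder rs r) (orth_remainder rs y)"

lemma diff_orth_remainder_in_span: "y - orth_remainder rs y \<in> span (set rs)"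
proof (induction rs arbitrary: y)
  case (Cons r rs)
  let ?u = "orth_remainder rs r"
  define t where "t = (?u \<bullet> orth_remainder rs y) / (?u \<bullet> ?u)"
  have mono: "span (set rs) \<subseteq> span (set (r # rs))" by (rule span_mono) auto
  have ru: "r - ?u \<in> span (set (r # rs))" and yu: "y - orth_remainder rs y \<in> span (set (r # rs))"
    using Cons.IH mono by blast+
  have "r \<in> span (set (r # rs))" by (simp add: span_base)
  then have "(y - orth_remainder rs y) + t *\<^sub>R (r - (r - ?u)) \<in> span (set (r # rs))"
    by (rule span_add[OF yu span_scale[OF span_diff[OF _ ru]]])
  moreover have "y - orth_remainder (r # rs) y = (y - orth_remainder rs y) + t *\<^sub>R (r - (r - ?u))"
    by (simp add: remove_component_def t_def)
  ultimately show ?case by (simp only:)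
qed (simp add: span_zero)

lemma orth_remainder_orthogonal: "a \<in> set rs \<Longrightarrow> a \<bullet> orth_remainder rs y = 0"
proof (induction rs arbitrary: y a)
  case (Cons r rs)
  define u where "u = orth_remainder rs r"
  define z where "z = orth_remainder (r # rs) y"
  have z: "z = remove_component u (orth_remainder rs y)" by (simp add: z_def u_def)
  have old: "b \<bullet> z = 0" if "b \<in> set rs" for b
    using Cons.IH[OF that] by (simp add: z u_def remove_component_def inner_diff_right)
  have "orthogonal z (r - u)"
  proof (rule orthogonal_to_span)
    show "r - u \<in> span (set rs)" unfolding u_def by (rule diff_orth_remainder_in_span)
    show "orthogonal z b" if "b \<in> set rs" for b
      using old[OF that] by (simp add: orthogonal_def inner_commute)
  qed
  then have "z \<bullet> r = z \<bullet> u" by (simp add: orthogonal_def inner_diff_right)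
  also have "\<dots> = 0" unfolding z by (subst inner_commute) (rule inner_remove_component)
  finally have "r \<bullet> z = 0" by (simp add: inner_commute)
  with old Cons.prems show ?case unfolding z_def[symmetric] by auto
qed simp

text \<open>
  Removing single components one after the other subtracts some element of the span; the remainder is
  the shortest vector that can be obtained in this way. A joint projection is therefore
  at least as good as a sweep of rank-one projections, and only the sweep
  is a composition of independent maps when the rows are independent.
\<close>
lemma norm_orth_remainder_le_sweep:
  "norm (orth_remainder rs y) \<le> norm (foldr remove_component rs y)"
proof -
  let ?g = "orth_remainder rs y" and ?k = "foldr remove_component rs y"
  have "y - foldr remove_component ts y \<in> span (set ts)" for ts
  proof (induction ts)
    case (Cons r ts)
    let ?f = "foldr remove_component ts y"
    have "y - ?f \<in> span (set (r # ts))"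
      using Cons.IH span_mono[of "set ts" "set (r # ts)"] by auto
    then have "(y - ?f) + ((r \<bullet> ?f) / (r \<bullet> r)) *\<^sub>R r \<in> span (set (r # ts))"
      by (intro span_add span_scale) (auto intro: span_base)
    then show ?case by (simp add: remove_component_def[of r] algebra_simps)
  qed (simp add: span_zero)
  then have "(y - ?g) - (y - ?k) \<in> span (set rs)"
    using diff_orth_remainder_in_span span_diff by blast
  then have "orthogonal ?g ((y - ?g) - (y - ?k))"
    by (rule orthogonal_to_span) (simp add: orthogonal_def orth_remainder_orthogonal inner_commute)
  then have "?g \<bullet> (?k - ?g) = 0" by (simp add: orthogonal_def)
  then have "(norm ?k)\<^sup>2 = (norm ?g)\<^sup>2 + (norm (?k - ?g))\<^sup>2"
    using norm_add_Pythagorean[of ?g "?k - ?g"] by (simp add: orthogonal_def)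
  then have "(norm ?g)\<^sup>2 \<le> (norm ?k)\<^sup>2" by simp
  then show ?thesis by (simp add: power2_le_iff_abs_le)
qed

lemma measurable_remove_component [measurable (raw)]:
  fixes f g :: "'w \<Rightarrow> 'a::euclidean_space"
  assumes [measurable]: "f \<in> borel_measurable M" "g \<in> borel_measurable M"
  shows "(\<lambda>\<omega>. remove_component (f \<omega>) (g \<omega>)) \<in> borel_measurable M"
  unfolding remove_component_def by measurable

lemma measurable_orth_remainder:
  fixes f :: "'i \<Rightarrow> 'w \<Rightarrow> 'a::euclidean_space"
  assumes "\<And>i. f i \<in> borel_measurable M" and g: "g \<in> borel_measurable M"
  shows "(\<lambda>\<omega>. orth_remainder (map (\<lambda>i. f i \<omega>) L) (g \<omega>)) \<in> borel_measurable M"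
  using g
proof (induction L arbitrary: g)
  case (Cons i L)
  show ?case
    using measurable_remove_component[OF Cons.IH[of "f i"] Cons.IH[OF Cons.prems]] assms(1) by simp
qed simp

section \<open>Composing independent random contractions\<close>

text \<open>
  Independent random maps, each contracting the mean square norm by \<open>c\<close> on a common invariant set, contract
  it by \<open>c ^ n\<close> in composition. The outermost map is independent of everything inside, so
  Fubini applied to the joint law reduces its effect to the contraction at a fixed vector. The lemma is
  used twice: for the rows of one sketch, and for the successive iterations.
\<close>
lemma (in prob_space) expected_norm_after_independent_contractions:
  fixes X :: "'i \<Rightarrow> 'a \<Rightarrow> 'p::topological_space"
    and T :: "'p \<Rightarrow> 'v::euclidean_space \<Rightarrow> 'v"
  assumes indep: "indep_vars (\<lambda>_. borel) X I"
    and T: "case_prod T \<in> borel_measurable (borel \<Otimes>\<^sub>M borel)"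
    and V: "\<And>p y. y \<in> V \<Longrightarrow> T p y \<in> V"
    and c: "0 \<le> c"
    and contr: "\<And>i y. i \<in> I \<Longrightarrow> y \<in> V \<Longrightarrow>
      (\<integral>\<^sup>+\<omega>. ennreal ((norm (T (X i \<omega>) y))\<^sup>2) \<partial>M) \<le> ennreal (c * (norm y)\<^sup>2)"
    and y: "y \<in> V" and L: "distinct L" "set L \<subseteq> I"
  shows "(\<integral>\<^sup>+\<omega>. ennreal ((norm (foldr (\<lambda>i. T (X i \<omega>)) L y))\<^sup>2) \<partial>M)
           \<le> ennreal (c ^ length L * (norm y)\<^sup>2)"
  using L
proof (induction L)
  case Nil
  then show ?case by (simp add: emeasure_space_1)
next
  case (Cons i L)
  define Y where "Y f = foldr (\<lambda>j. T (f j)) L y" for f :: "'i \<Rightarrow> 'p"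
  have T': "(\<lambda>\<omega>. T (f \<omega>) (g \<omega>)) \<in> borel_measurable N"
    if "f \<in> borel_measurable N" "g \<in> borel_measurable N" for f g and N :: "'z measure"
    using measurable_compose[OF measurable_Pair[OF that] T] by simp
  have Ym: "Y \<in> borel_measurable (PiM (set L) (\<lambda>_. borel))"
  proof -
    have "(\<lambda>f. foldr (\<lambda>j. T (f j)) L' y) \<in> borel_measurable (PiM (set L) (\<lambda>_. borel))"
      if "set L' \<subseteq> set L" for L' using that
    proof (induction L')
      case (Cons j L')
      have "(\<lambda>f. f j) \<in> borel_measurable (PiM (set L) (\<lambda>_. borel :: 'p measure))"
        using Cons.prems by (intro measurable_component_singleton) simp
      moreover have "(\<lambda>f. foldr (\<lambda>j. T (f j)) L' y) \<in> borel_measurable (PiM (set L) (\<lambda>_. borel))"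
        using Cons.IH Cons.prems by simp
      ultimately have "(\<lambda>f. T (f j) (foldr (\<lambda>j. T (f j)) L' y)) \<in> borel_measurable (PiM (set L) (\<lambda>_. borel))"
        by (rule T')
      then show ?case by simp
    qed simp
    then show ?thesis by (simp add: Y_def[abs_def])
  qed
  let ?P1 = "PiM (set L) (\<lambda>_. borel) :: ('i \<Rightarrow> 'p) measure"
  let ?P2 = "PiM {i} (\<lambda>_. borel) :: ('i \<Rightarrow> 'p) measure"
  define R1 where "R1 \<omega> = restrict (\<lambda>j. X j \<omega>) (set L)" for \<omega>
  define R2 where "R2 \<omega> = restrict (\<lambda>j. X j \<omega>) {i}" for \<omega>
  have i: "i \<in> I" using Cons.prems by simp
  \<comment> \<open>The inner maps and the outermost one see disjoint blocks of variables; \<open>R1\<close> and \<open>R2\<close> are these blocks.\<close>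
  have "indep_var ?P1 R1 ?P2 R2"
    unfolding R1_def R2_def using Cons.prems by (intro indep_var_restrict[OF indep]) auto
  note joint = indep_var_distribution_eq[THEN iffD1, OF this]
  have R1m [measurable]: "R1 \<in> measurable M ?P1" and R2m [measurable]: "R2 \<in> measurable M ?P2"
    using joint by auto
  have YR1: "Y (R1 \<omega>) = foldr (\<lambda>j. T (X j \<omega>)) L y" for \<omega>
    unfolding Y_def R1_def by (intro foldr_cong) auto
  have R2i: "R2 \<omega> i = X i \<omega>" for \<omega> by (simp add: R2_def)
  have YV: "Y f \<in> V" for f
  proof -
    have "foldr (\<lambda>j. T (f j)) L' y \<in> V" for L' by (induction L') (auto simp: y V)
    then show ?thesis by (simp add: Y_def)
  qed
  let ?h = "\<lambda>x. ennreal ((norm (T (snd x i) (Y (fst x))))\<^sup>2)"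
  interpret P2: prob_space "distr M ?P2 R2" by (rule prob_space_distr) simp
  have hm [measurable]: "?h \<in> borel_measurable (?P1 \<Otimes>\<^sub>M ?P2)"
  proof -
    have "(\<lambda>x. Y (fst x)) \<in> borel_measurable (?P1 \<Otimes>\<^sub>M ?P2)"
      by (rule measurable_compose[OF measurable_fst Ym])
    moreover have "(\<lambda>x. snd x i) \<in> borel_measurable (?P1 \<Otimes>\<^sub>M ?P2)"
      by (rule measurable_compose[OF measurable_snd measurable_component_singleton]) simp
    ultimately have [measurable]: "(\<lambda>x. T (snd x i) (Y (fst x))) \<in> borel_measurable (?P1 \<Otimes>\<^sub>M ?P2)"
      by (intro T'[of "\<lambda>x. snd x i"])
    show ?thesis by measurable
  qed
  have hm2: "?h \<in> borel_measurable (?P1 \<Otimes>\<^sub>M distr M ?P2 R2)"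
    using hm by (simp cong: measurable_cong_sets)
  have hm3: "(\<lambda>g. ?h (f, g)) \<in> borel_measurable ?P2" if "f \<in> space ?P1" for f
    using measurable_compose[OF measurable_Pair1'[OF that] hm] by simp
  have "(\<integral>\<^sup>+\<omega>. ennreal ((norm (foldr (\<lambda>j. T (X j \<omega>)) (i # L) y))\<^sup>2) \<partial>M)
      = (\<integral>\<^sup>+\<omega>. ?h (R1 \<omega>, R2 \<omega>) \<partial>M)"
    by (simp add: YR1 R2i)
  also have "\<dots> = (\<integral>\<^sup>+x. ?h x \<partial>distr M (?P1 \<Otimes>\<^sub>M ?P2) (\<lambda>\<omega>. (R1 \<omega>, R2 \<omega>)))"
    using hm by (intro nn_integral_distr[symmetric]) auto
  also have "\<dots> = (\<integral>\<^sup>+x. ?h x \<partial>(distr M ?P1 R1 \<Otimes>\<^sub>M distr M ?P2 R2))"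
    using joint by simp
  also have "\<dots> = (\<integral>\<^sup>+f. (\<integral>\<^sup>+g. ?h (f, g) \<partial>distr M ?P2 R2) \<partial>distr M ?P1 R1)"
    using hm by (intro P2.nn_integral_fst[symmetric]) (simp cong: measurable_cong_sets)
  also have "\<dots> = (\<integral>\<^sup>+\<omega>'. (\<integral>\<^sup>+g. ?h (R1 \<omega>', g) \<partial>distr M ?P2 R2) \<partial>M)"
    using P2.borel_measurable_nn_integral_fst[OF hm2] by (intro nn_integral_distr) auto
  also have "\<dots> = (\<integral>\<^sup>+\<omega>'. (\<integral>\<^sup>+\<omega>. ?h (R1 \<omega>', R2 \<omega>) \<partial>M) \<partial>M)"
  proof (rule nn_integral_cong)
    fix \<omega>' assume "\<omega>' \<in> space M"
    then have "R1 \<omega>' \<in> space ?P1" by (rule measurable_space[OF R1m])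
    then show "(\<integral>\<^sup>+g. ?h (R1 \<omega>', g) \<partial>distr M ?P2 R2) = (\<integral>\<^sup>+\<omega>. ?h (R1 \<omega>', R2 \<omega>) \<partial>M)"
      using hm3 by (intro nn_integral_distr R2m) (simp only: measurable_distr_eq1)
  qed
  also have "\<dots> \<le> (\<integral>\<^sup>+\<omega>'. ennreal c * ennreal ((norm (Y (R1 \<omega>')))\<^sup>2) \<partial>M)"
    using contr[OF i YV] c by (intro nn_integral_mono) (simp add: ennreal_mult R2i)
  also have "\<dots> = ennreal c * (\<integral>\<^sup>+\<omega>'. ennreal ((norm (Y (R1 \<omega>')))\<^sup>2) \<partial>M)"
  proof (intro nn_integral_cmult)
    have [measurable]: "(\<lambda>\<omega>'. Y (R1 \<omega>')) \<in> borel_measurable M"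
      by (rule measurable_compose[OF R1m Ym])
    show "(\<lambda>\<omega>'. ennreal ((norm (Y (R1 \<omega>')))\<^sup>2)) \<in> borel_measurable M" by measurable
  qed
  also have "\<dots> \<le> ennreal c * ennreal (c ^ length L * (norm y)\<^sup>2)"
    using Cons.IH Cons.prems by (intro mult_left_mono) (auto simp: YR1)
  also have "\<dots> = ennreal (c ^ length (i # L) * (norm y)\<^sup>2)"
    using c by (simp add: ennreal_mult[symmetric] mult.assoc)
  finally show ?case .
qed

section \<open>Projectors onto random lines\<close>

definition line_projector :: "real^'n \<Rightarrow> real^'n^'n" where
  "line_projector r = (\<chi> i j. (r$i * r$j) / (r \<bullet> r))"

lemma line_projector_mult: "line_projector r *v y = ((r \<bullet> y) / (r \<bullet> r)) *\<^sub>R r"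
  by (simp add: line_projector_def matrix_vector_mult_def vec_eq_iff inner_vec_def[of r y]
      sum_divide_distrib sum_distrib_left mult_ac)

text \<open>
  A crude bound, sufficient for integrability.
\<close>
lemma norm_line_projector_le: "norm (line_projector (r :: real^'n)) \<le> real (CARD('n) * CARD('n))"
proof -
  have entry: "\<bar>line_projector r $ i $ j\<bar> \<le> 1" for i j
  proof -
    have "\<bar>r$i\<bar> * \<bar>r$j\<bar> \<le> norm r * norm r"
      by (intro mult_mono component_le_norm_cart) auto
    also have "\<dots> = r \<bullet> r" by (simp add: dot_square_norm power2_eq_square)
    finally show ?thesis by (cases "r = 0") (auto simp: line_projector_def abs_mult)
  qed
  have row: "norm (line_projector r $ i) \<le> real CARD('n)" for i
  proof -
    have "norm (line_projector r $ i) \<le> (\<Sum>j\<in>UNIV. \<bar>line_projector r $ i $ j\<bar>)" by (rule norm_le_l1_cart)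
    also have "\<dots> \<le> (\<Sum>j\<in>(UNIV::'n set). 1)" by (intro sum_mono entry)
    finally show ?thesis by simp
  qed
  have "norm (line_projector r) \<le> (\<Sum>i\<in>UNIV. norm (line_projector r $ i))"
    unfolding norm_vec_def[of "line_projector r"] by (rule L2_set_le_sum) simp
  also have "\<dots> \<le> (\<Sum>i\<in>(UNIV::'n set). real CARD('n))" by (intro sum_mono row)
  finally show ?thesis by simp
qed

lemma measurable_line_projector:
  fixes g :: "'w \<Rightarrow> real^'n"
  assumes [measurable]: "g \<in> borel_measurable M"
  shows "(\<lambda>\<omega>. line_projector (g \<omega>)) \<in> borel_measurable M"
proof -
  have "continuous_on UNIV (\<lambda>r::real^'n. (\<chi> i j. r$i * r$j) :: real^'n^'n)"
    by (intro continuous_intros)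
  then have "(\<lambda>r::real^'n. (\<chi> i j. r$i * r$j) :: real^'n^'n) \<in> borel_measurable borel"
    by (rule borel_measurable_continuous_onI)
  from measurable_compose[OF assms this]
  have [measurable]: "(\<lambda>\<omega>. (\<chi> i j. g \<omega>$i * g \<omega>$j) :: real^'n^'n) \<in> borel_measurable M" .
  have "line_projector r = inverse (r \<bullet> r) *\<^sub>R (\<chi> i j. r$i * r$j)" for r :: "real^'n"
    by (simp add: line_projector_def vec_eq_iff divide_inverse_commute)
  then show ?thesis by simp
qed

text \<open>
  The mean of \<open>|y - Z y|\<^sup>2 = |y|\<^sup>2 - y \<bullet> Z y\<close> is \<open>|y|\<^sup>2 - y \<bullet> E[Z] y\<close>, and \<open>y\<close> is orthogonal to the kernel of
  \<open>E[Z]\<close>. As this mean is not negative, the factor is not negative either once such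
  a \<open>y \<noteq> 0\<close> exists; both conclusions are drawn from the same estimate.
\<close>
lemma (in prob_space)
  fixes g :: "'a \<Rightarrow> real^'n"
  assumes g [measurable]: "g \<in> borel_measurable M"
    and y: "\<And>w. w \<in> null_space (expectation (\<lambda>\<omega>. line_projector (g \<omega>))) \<Longrightarrow> w \<bullet> y = 0"
  shows expected_norm_remove_component:
    "(\<integral>\<^sup>+\<omega>. ennreal ((norm (remove_component (g \<omega>) y))\<^sup>2) \<partial>M)
       \<le> ennreal ((1 - lambda_min_pos (expectation (\<lambda>\<omega>. line_projector (g \<omega>)))) * (norm y)\<^sup>2)"
    and lambda_min_pos_expected_line_projector_le_1:
    "y \<noteq> 0 \<Longrightarrow> lambda_min_pos (expectation (\<lambda>\<omega>. line_projector (g \<omega>))) \<le> 1"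
proof -
  let ?Z = "\<lambda>\<omega>. line_projector (g \<omega>)"
  let ?EZ = "expectation ?Z"
  have intZ: "integrable M ?Z"
    using norm_line_projector_le measurable_line_projector[OF g]
    by (intro integrable_const_bound) auto
  have "bounded_linear (\<lambda>N::real^'n^'n. x \<bullet> (N *v z))" for x z
    by (intro linear_conv_bounded_linear[THEN iffD1] linearI)
      (simp_all add: matrix_vector_mult_add_rdistrib inner_add_right scaleR_matrix_vector_assoc[symmetric])
  note form = integral_bounded_linear[OF this intZ] integrable_bounded_linear[OF this intZ]
  have "transpose ?EZ = ?EZ"
  proof -
    have "x \<bullet> (transpose ?EZ *v z) = x \<bullet> (?EZ *v z)" for x z
    proof -
      have "x \<bullet> (transpose ?EZ *v z) = z \<bullet> (?EZ *v x)"
        by (subst inner_matrix_vector[symmetric]) (rule inner_commute)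
      also have "\<dots> = x \<bullet> (?EZ *v z)"
        unfolding form(1)[symmetric] by (simp add: line_projector_mult inner_commute mult.commute)
      finally show ?thesis .
    qed
    then have "transpose ?EZ *v z = ?EZ *v z" for z
      by (rule vector_eq_ldot[THEN iffD1, OF allI])
    then show ?thesis by (simp add: matrix_eq)
  qed
  from lambda_min_pos_le_form[OF this y]
  have low: "lambda_min_pos ?EZ * (norm y)\<^sup>2 \<le> y \<bullet> (?EZ *v y)" by (simp add: dot_square_norm)
  have sq: "(norm (remove_component (g \<omega>) y))\<^sup>2 = (norm y)\<^sup>2 - y \<bullet> (?Z \<omega> *v y)" for \<omega>
    by (simp only: norm_remove_component line_projector_mult)
  have "expectation (\<lambda>\<omega>. (norm (remove_component (g \<omega>) y))\<^sup>2) = (norm y)\<^sup>2 - y \<bullet> (?EZ *v y)"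
    unfolding sq using form[of y y] by (simp add: prob_space)
  also have "\<dots> \<le> (1 - lambda_min_pos ?EZ) * (norm y)\<^sup>2"
    using low by (simp add: algebra_simps)
  finally have real_bound: "expectation (\<lambda>\<omega>. (norm (remove_component (g \<omega>) y))\<^sup>2)
      \<le> (1 - lambda_min_pos ?EZ) * (norm y)\<^sup>2" .
  have "(\<integral>\<^sup>+\<omega>. ennreal ((norm (remove_component (g \<omega>) y))\<^sup>2) \<partial>M)
      = ennreal (expectation (\<lambda>\<omega>. (norm (remove_component (g \<omega>) y))\<^sup>2))"
  proof (rule nn_integral_eq_integral)
    show "integrable M (\<lambda>\<omega>. (norm (remove_component (g \<omega>) y))\<^sup>2)"
      unfolding sq using form(2)[of y y] by simp
  qed simp
  then show "(\<integral>\<^sup>+\<omega>. ennreal ((norm (remove_component (g \<omega>) y))\<^sup>2) \<partial>M)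
       \<le> ennreal ((1 - lambda_min_pos ?EZ) * (norm y)\<^sup>2)"
    using real_bound by (simp add: ennreal_leI)
  have "0 \<le> expectation (\<lambda>\<omega>. (norm (remove_component (g \<omega>) y))\<^sup>2)"
    by (intro integral_nonneg_AE) simp
  from order_trans[OF this real_bound]
  have nonneg: "0 \<le> (1 - lambda_min_pos ?EZ) * (norm y)\<^sup>2" .
  show "lambda_min_pos ?EZ \<le> 1" if "y \<noteq> 0"
  proof -
    have "0 < (norm y)\<^sup>2" using that by simp
    then have "0 \<le> 1 - lambda_min_pos ?EZ" using nonneg by (simp only: zero_le_mult_iff) linarith
    then show ?thesis by simp
  qed
qed

section \<open>The method in transformed coordinates\<close>

text \<open>
  Pythagoras in the weighted inner product: orthogonality of the residual \<open>z - y\<close> to all feasible differences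
  makes \<open>z\<close> the only minimiser, so the choice made by \<^const>\<open>arg_min\<close> is determined.
\<close>
lemma weighted_arg_min_eqI:
  fixes B :: "real^'n^'n"
  assumes B: "sym_posdef B" and feas: "F z"
    and orth: "\<And>x. F x \<Longrightarrow> (spd_sqrt B *v (z - y)) \<bullet> (spd_sqrt B *v (x - z)) = 0"
  shows "arg_min (\<lambda>x. weighted_norm B (x - y)) F = z"
proof -
  let ?C = "spd_sqrt B"
  have pyth: "(norm (?C *v (x - y)))\<^sup>2 = (norm (?C *v (z - y)))\<^sup>2 + (norm (?C *v (x - z)))\<^sup>2" if "F x" for x
  proof -
    have "?C *v (x - y) = ?C *v (z - y) + ?C *v (x - z)"
      by (simp add: matrix_vector_mult_diff_distrib)
    moreover have "orthogonal (?C *v (z - y)) (?C *v (x - z))"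
      using orth[OF that] by (simp add: orthogonal_def)
    ultimately show ?thesis by (simp only: norm_add_Pythagorean)
  qed
  have "x = z" if x: "F x" "\<not> weighted_norm B (z - y) < weighted_norm B (x - y)" for x
  proof -
    have "norm (?C *v (x - y)) \<le> norm (?C *v (z - y))"
      using x(2) by (simp add: weighted_norm_conv_norm[OF B])
    then have "(norm (?C *v (x - y)))\<^sup>2 \<le> (norm (?C *v (z - y)))\<^sup>2" by (simp add: power_mono)
    with pyth[OF x(1)] have "(norm (?C *v (x - z)))\<^sup>2 \<le> 0" by linarith
    then have "?C *v (x - z) = 0" by simp
    then have "inv_sqrt B *v (?C *v (x - z)) = 0" by simp
    then show ?thesis by (simp add: matrix_vector_mul_assoc inv_sqrt[OF B])
  qed
  moreover have "weighted_norm B (z - y) \<le> weighted_norm B (x - y)" if "F x" for x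
  proof -
    have "(norm (?C *v (z - y)))\<^sup>2 \<le> (norm (?C *v (x - y)))\<^sup>2" using pyth[OF that] by simp
    then show ?thesis by (simp add: weighted_norm_conv_norm[OF B] power2_le_iff_abs_le)
  qed
  ultimately show ?thesis
    unfolding arg_min_def is_arg_min_def using feas by (intro some_equality) (auto simp: not_less)
qed

lemma constraint_proj:
  assumes "H = Q ** A ** inv_sqrt B"
  shows "transpose (constraint_proj A B Q) = constraint_proj A B Q"
    and "H *v (constraint_proj A B Q *v y) = 0"
    and "H *v y = 0 \<Longrightarrow> constraint_proj A B Q *v y = y"
  using pinv_complement_projector[of H] by (simp_all add: constraint_proj_def assms)

text \<open>
  The row \<open>t\<^sup>T A C\<^sup>-\<^sup>1 P\<close> as a column vector, the direction in which a sketch with row \<open>t\<close> can correct the error.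
\<close>
definition sketch_direction :: "real^'n^'m \<Rightarrow> real^'n^'n \<Rightarrow> real^'m^'d \<Rightarrow> real^'m \<Rightarrow> real^'n" where
  "sketch_direction A B Q t = constraint_proj A B Q *v (inv_sqrt B *v (transpose A *v t))"

lemma inner_sketch_direction:
  assumes B: "sym_posdef B"
  shows "sketch_direction A B Q t \<bullet> z = t \<bullet> (A *v (inv_sqrt B *v (constraint_proj A B Q *v z)))"
  by (simp add: sketch_direction_def inner_matrix_vector constraint_proj(1)[OF refl] inv_sqrt(3)[OF B])

lemma measurable_sketch_direction: "sketch_direction A B Q \<in> borel_measurable borel"
proof -
  have "sketch_direction A B Q = (*v) (constraint_proj A B Q ** inv_sqrt B ** transpose A)"
    by (simp add: sketch_direction_def fun_eq_iff matrix_vector_mul_assoc matrix_mul_assoc)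
  then show ?thesis
    by (simp add: borel_measurable_continuous_onI linear_continuous_on linear_conv_bounded_linear[symmetric])
qed

lemma row_proj_eq_line_projector:
  fixes A :: "real^'n^'m"
  assumes B: "sym_posdef B"
  shows "row_proj A B Q s = line_projector (sketch_direction A B Q s)"
proof -
  let ?P = "constraint_proj A B Q" and ?K = "inv_sqrt B"
  have "(rowvector s :: real^'m^1) ** N = rowvector (transpose N *v s)" for N :: "real^'n^'m"
    by (simp add: rowvector_def matrix_matrix_mult_def matrix_vector_mult_def transpose_def vec_eq_iff mult.commute)
  moreover have "transpose (A ** ?K ** ?P) = ?P ** ?K ** transpose A"
    by (simp add: matrix_transpose_mul inv_sqrt(3)[OF B] constraint_proj(1)[OF refl] matrix_mul_assoc)
  ultimately have "(rowvector s :: real^'m^1) ** A ** ?K ** ?P = rowvector (sketch_direction A B Q s)"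
    unfolding sketch_direction_def by (metis matrix_mul_assoc matrix_vector_mul_assoc)
  then have "row_proj A B Q s *v y = line_projector (sketch_direction A B Q s) *v y" for y
    by (simp only: row_proj_def Let_def line_projector_mult pinv_rowvector)
  then show ?thesis by (simp add: matrix_eq)
qed

text \<open>
  In the transformed coordinates the solution set is a translate of the kernel of \<open>A C\<^sup>-\<^sup>1\<close>, and the nearest
  point of it leaves a residual orthogonal to that kernel.
\<close>
lemma target_solution_residual:
  fixes A :: "real^'n^'m"
  assumes B: "sym_posdef B" and p: "A *v p = b"
  shows "A *v target_solution A b B x0 = b"
    and "A *v (inv_sqrt B *v w) = 0 \<Longrightarrow> (spd_sqrt B *v (x0 - target_solution A b B x0)) \<bullet> w = 0"
proof -
  let ?C = "spd_sqrt B" and ?K = "inv_sqrt B"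
  have KC: "?K *v (?C *v x) = x" and CK: "?C *v (?K *v x) = x" for x
    using inv_sqrt(1,2)[OF B] by (simp_all add: matrix_vector_mul_assoc)
  define U where "U = {u. A *v (?K *v u) = 0}"
  have U: "subspace U"
    by (auto simp: U_def subspace_def matrix_vector_right_distrib matrix_vector_mult_scaleR)
  obtain u v where uv: "u \<in> U" "\<And>w. w \<in> U \<Longrightarrow> orthogonal v w" "?C *v (x0 - p) = u + v"
    by (rule orthogonal_subspace_decomp_exists[of U "?C *v (x0 - p)", unfolded span_eq_iff[THEN iffD2, OF U]])
      (rule that)
  define xs where "xs = p + ?K *v u"
  have Axs: "A *v xs = b" using uv(1) by (simp add: xs_def U_def p matrix_vector_right_distrib)
  have C0: "?C *v (x0 - xs) = v"
  proof -
    have "?C *v (x0 - xs) = ?C *v (x0 - p) - ?C *v (?K *v u)"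
      by (simp add: xs_def matrix_vector_mult_diff_distrib matrix_vector_right_distrib)
    then show ?thesis by (simp add: CK uv(3))
  qed
  have target: "target_solution A b B x0 = xs"
    unfolding target_solution_def
  proof (rule weighted_arg_min_eqI[OF B])
    show "A *v xs = b" by (rule Axs)
    fix x assume "A *v x = b"
    then have "?C *v (x - xs) \<in> U" by (simp add: U_def KC matrix_vector_mult_diff_distrib Axs)
    moreover have "?C *v (xs - x0) = - v" using C0 by (simp add: matrix_vector_mult_diff_distrib algebra_simps)
    ultimately show "(?C *v (xs - x0)) \<bullet> (?C *v (x - xs)) = 0"
      using uv(2) by (simp add: orthogonal_def)
  qed
  show "A *v target_solution A b B x0 = b" by (simp add: target Axs)
  show "A *v (?K *v w) = 0 \<Longrightarrow> (?C *v (x0 - target_solution A b B x0)) \<bullet> w = 0"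
    using uv(2)[of w] by (simp add: target C0 U_def orthogonal_def)
qed

text \<open>
  Feasible differences \<open>d\<close> satisfy the constraint given by \<open>Q\<close>, so \<open>P\<close> fixes them; for such \<open>d\<close> the sketched
  equations say precisely that \<open>d\<close> is orthogonal to the sketch directions. Projecting the error to the
  complement of these directions is therefore the step of the method. The list \<open>rs\<close> may enumerate the
  directions in any order and with repetitions.
\<close>
lemma sketch_step:
  fixes A :: "real^'n^'m" and Q :: "real^'m^'d" and R :: "real^'m^'l"
  assumes B: "sym_posdef B" and Axs: "A *v xs = b"
    and y: "y = spd_sqrt B *v (x - xs)" "Q *v (A *v (inv_sqrt B *v y)) = 0"
    and rs: "set rs = range (\<lambda>i. sketch_direction A B Q (R $ i))"
  shows "spd_sqrt B *v (arg_min (\<lambda>z. weighted_norm B (z - x))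
           (\<lambda>z. (R ** A) *v z = R *v b \<and> (Q ** A) *v z = Q *v b) - xs) = orth_remainder rs y"
proof -
  let ?C = "spd_sqrt B" and ?K = "inv_sqrt B"
  let ?F = "\<lambda>x. (R ** A) *v x = R *v b \<and> (Q ** A) *v x = Q *v b"
  have KC: "?K *v (?C *v x) = x" and CK: "?C *v (?K *v x) = x" for x
    using inv_sqrt(1,2)[OF B] by (simp_all add: matrix_vector_mul_assoc)
  have P_fix: "Q *v (A *v (?K *v x)) = 0 \<Longrightarrow> constraint_proj A B Q *v x = x" for x
    using constraint_proj(3)[OF refl] by (simp add: matrix_vector_mul_assoc matrix_mul_assoc)
  have "Q *v (A *v (?K *v (constraint_proj A B Q *v x))) = 0" for x
    using constraint_proj(2)[OF refl] by (simp add: matrix_vector_mul_assoc matrix_mul_assoc)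
  then have QG: "Q *v (A *v (?K *v (sketch_direction A B Q t))) = 0" for t
    by (simp add: sketch_direction_def)
  have Rmult: "(R *v a) $ i = R $ i \<bullet> a" for a i
    by (simp add: matrix_vector_mult_def inner_vec_def)
  define z where "z = orth_remainder rs y"
  have yz: "y - z \<in> span (set rs)" unfolding z_def by (rule diff_orth_remainder_in_span)
  have Qz: "Q *v (A *v (?K *v z)) = 0"
  proof -
    have "subspace {u. Q *v (A *v (?K *v u)) = 0}"
      by (auto simp: subspace_def matrix_vector_right_distrib matrix_vector_mult_scaleR)
    then have "span (set rs) \<subseteq> {u. Q *v (A *v (?K *v u)) = 0}"
      using QG by (intro span_minimal) (auto simp: rs)
    then have "Q *v (A *v (?K *v (y - z))) = 0" using yz by blast
    then show ?thesis using y(2) by (simp add: matrix_vector_mult_diff_distrib)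
  qed
  have "(R *v (A *v (?K *v z))) $ i = 0" for i
  proof -
    have "sketch_direction A B Q (R $ i) \<bullet> z = 0"
      unfolding z_def by (rule orth_remainder_orthogonal) (simp add: rs)
    then show ?thesis unfolding inner_sketch_direction[OF B] P_fix[OF Qz] Rmult .
  qed
  then have Rz: "R *v (A *v (?K *v z)) = 0" by (simp add: vec_eq_iff)
  have feas: "?F (xs + ?K *v z)"
    using Rz Qz by (simp add: matrix_vector_mul_assoc[symmetric] matrix_vector_right_distrib Axs)
  have "arg_min (\<lambda>z. weighted_norm B (z - x)) ?F = xs + ?K *v z"
  proof (rule weighted_arg_min_eqI[OF B])
    show "?F (xs + ?K *v z)" by (rule feas)
    fix x' assume x': "?F x'"
    define d where "d = ?C *v (x' - (xs + ?K *v z))"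
    have Kd: "?K *v d = x' - (xs + ?K *v z)" by (simp add: d_def KC)
    have Rd: "R *v (A *v (?K *v d)) = 0" and Qd: "Q *v (A *v (?K *v d)) = 0"
      using x' feas
      by (simp_all add: Kd matrix_vector_mul_assoc[symmetric] matrix_vector_mult_diff_distrib)
    have "sketch_direction A B Q (R $ i) \<bullet> d = 0" for i
      unfolding inner_sketch_direction[OF B] P_fix[OF Qd] Rmult[symmetric] Rd by simp
    then have "orthogonal d (y - z)"
      by (intro orthogonal_to_span[OF yz]) (auto simp: rs orthogonal_def inner_commute)
    moreover have "?C *v (xs + ?K *v z - x) = z - y"
    proof -
      have "?C *v (xs + ?K *v z - x) = ?C *v (?K *v z) - ?C *v (x - xs)"
        by (simp add: matrix_vector_mult_diff_distrib matrix_vector_right_distrib)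
      then show ?thesis by (simp add: CK y(1))
    qed
    ultimately show "(?C *v (xs + ?K *v z - x)) \<bullet> (?C *v (x' - (xs + ?K *v z))) = 0"
      by (simp add: d_def[symmetric] orthogonal_def inner_diff_left inner_diff_right inner_commute)
  qed
  then show ?thesis by (simp add: CK z_def)
qed

section \<open>Convergence in mean square\<close>

theorem proposition2p8:
  fixes A :: "real^'n^'m" and b :: "real^'m" and B :: "real^'n^'n" and Q :: "real^'m^'d"
    and x0 :: "real^'n"
    and N :: "'v measure" and s :: "'l::finite \<Rightarrow> 'v \<Rightarrow> real^'m" and i1 :: 'l
    and M :: "'w measure" and S :: "nat \<Rightarrow> 'w \<Rightarrow> real^'m^'l"
    and EZ :: "real^'n^'n" and k :: nat
  assumes consistent: "\<exists>x. A *v x = b"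
    and B: "sym_posdef B"
    and dim: "CARD('d) < CARD('m)"
    and x0: "(Q ** A) *v x0 = Q *v b"
    and N: "prob_space N"
    and rows_indep: "prob_space.indep_vars N (\<lambda>_. borel) s UNIV"
    and rows_identical: "\<And>i j. distr N borel (s i) = distr N borel (s j)"
    and EZ_def: "EZ = prob_space.expectation N (\<lambda>\<omega>. row_proj A B Q (s i1 \<omega>))"
    and null: "null_space EZ = null_space (A ** inv_sqrt B ** constraint_proj A B Q)"
    and M: "prob_space M"
    and S_indep: "prob_space.indep_vars M (\<lambda>_. borel) S UNIV"
    and S_copies: "\<And>j. distr M borel (S j) = distr N borel (\<lambda>\<omega>. \<chi> i. s i \<omega>)"
  defines "err \<equiv> \<lambda>j \<omega>. (weighted_norm B
             (scsp_iterate A b B Q x0 (\<lambda>i. S i \<omega>) j - target_solution A b B x0))\<^sup>2"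
  shows "integrable M (err k) \<and>
         prob_space.expectation M (err k) \<le>
           (1 - lambda_min_pos EZ) ^ (CARD('l) * k) *
             (weighted_norm B (x0 - target_solution A b B x0))\<^sup>2"
proof -
  interpret N: prob_space N by (rule N)
  interpret M: prob_space M by (rule M)
  define K where "K = inv_sqrt B"
  define P where "P = constraint_proj A B Q"
  define G where "G = sketch_direction A B Q"
  define xs where "xs = target_solution A b B x0"
  define v where "v = spd_sqrt B *v (x0 - xs)"
  obtain p where p: "A *v p = b" using consistent by blast
  have Axs: "A *v xs = b"
    and residual: "\<And>w. A *v (K *v w) = 0 \<Longrightarrow> v \<bullet> w = 0"
    using target_solution_residual[OF B p, where ?x0.0 = x0] by (simp_all add: xs_def v_def K_def)
  have KC: "K *v (spd_sqrt B *v x) = x" for x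
    using inv_sqrt(1)[OF B] by (simp add: K_def matrix_vector_mul_assoc)
  have QP: "Q *v (A *v (K *v (P *v x))) = 0" for x
    using constraint_proj(2)[OF refl] by (simp add: K_def P_def matrix_vector_mul_assoc matrix_mul_assoc)
  have kernel: "w \<in> null_space EZ \<longleftrightarrow> A *v (K *v (P *v w)) = 0" for w
    unfolding null by (simp add: null_space_def K_def P_def matrix_vector_mul_assoc[symmetric])

  \<comment> \<open>The set that contains all errors: both the constraint and the eigenvalue bound are available on it.\<close>
  define V where "V = {y. Q *v (A *v (K *v y)) = 0 \<and> (\<forall>w\<in>null_space EZ. w \<bullet> y = 0)}"
  have V: "subspace V"
    by (auto simp: V_def subspace_def inner_add_right matrix_vector_right_distrib matrix_vector_mult_scaleR)
  have GV: "G t \<in> V" for t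
  proof -
    have "w \<bullet> G t = 0" if "w \<in> null_space EZ" for w
      using that inner_sketch_direction[OF B, of A Q t w]
      by (simp add: kernel G_def K_def P_def inner_commute)
    moreover have "Q *v (A *v (K *v (G t))) = 0" using QP by (simp add: G_def sketch_direction_def P_def)
    ultimately show ?thesis by (simp add: V_def)
  qed
  have vV: "v \<in> V"
  proof -
    have Qv: "Q *v (A *v (K *v v)) = 0"
      using x0 by (simp add: v_def KC matrix_vector_mult_diff_distrib Axs matrix_vector_mul_assoc[symmetric])
    then have Pv: "P *v v = v"
      using constraint_proj(3)[OF refl] by (simp add: K_def P_def matrix_vector_mul_assoc matrix_mul_assoc)
    have "w \<bullet> v = 0" if "w \<in> null_space EZ" for w
    proof -
      have "(P *v v) \<bullet> w = v \<bullet> (P *v w)"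
        by (simp add: P_def inner_matrix_vector constraint_proj(1)[OF refl])
      also have "\<dots> = 0" using that by (intro residual) (simp add: kernel)
      finally show ?thesis by (simp add: Pv inner_commute)
    qed
    with Qv show ?thesis by (simp add: V_def)
  qed

  \<comment> \<open>An arbitrary order in which the rows of a sketch are processed.\<close>
  obtain L :: "'l list" where L: "set L = UNIV" "distinct L"
    using finite_distinct_list[of "UNIV::'l set"] by auto
  then have lenL: "length L = CARD('l)" by (metis distinct_card)
  define T where "T R y = orth_remainder (map (\<lambda>i. G (R $ i)) L) y" for R :: "real^'m^'l" and y
  have TV: "T R y \<in> V" if "y \<in> V" for R y
  proof -
    let ?rs = "map (\<lambda>i. G (R $ i)) L"
    have "span (set ?rs) \<subseteq> V" using GV V by (intro span_minimal) auto
    then have "y - T R y \<in> V" using diff_orth_remainder_in_span[of y ?rs] by (auto simp: T_def)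
    from subspace_diff[OF V that this] show ?thesis by simp
  qed
  \<comment> \<open>\<^const>\<open>foldr\<close> applies the last list element first, hence the reversed order of iterations.\<close>
  define Y where "Y j \<omega> = foldr (\<lambda>i. T (S i \<omega>)) (rev [0..<j]) v" for j \<omega>
  have iterates: "spd_sqrt B *v (scsp_iterate A b B Q x0 (\<lambda>i. S i \<omega>) j - xs) = Y j \<omega> \<and> Y j \<omega> \<in> V" for j \<omega>
  proof (induction j)
    case 0
    then show ?case by (simp add: Y_def v_def[symmetric] vV)
  next
    case (Suc j)
    have "spd_sqrt B *v (scsp_iterate A b B Q x0 (\<lambda>i. S i \<omega>) (Suc j) - xs) = T (S j \<omega>) (Y j \<omega>)"
      unfolding T_def scsp_iterate.simps
      using Suc.IH L by (intro sketch_step[OF B Axs]) (auto simp: V_def K_def G_def)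
    then show ?case using Suc.IH TV by (simp add: Y_def)
  qed
  have err: "err j \<omega> = (norm (Y j \<omega>))\<^sup>2" for j \<omega>
    using iterates[of \<omega> j] by (simp add: err_def xs_def weighted_norm_conv_norm[OF B])
  have err0: "(weighted_norm B (x0 - target_solution A b B x0))\<^sup>2 = (norm v)\<^sup>2"
    by (simp add: weighted_norm_conv_norm[OF B] v_def xs_def)

  have Gm [measurable]: "G \<in> borel_measurable borel"
    unfolding G_def by (rule measurable_sketch_direction)
  have sm [measurable]: "s i \<in> borel_measurable N" for i
    using rows_indep by (simp add: N.indep_vars_def)
  have Sm [measurable]: "S j \<in> borel_measurable M" for j
    using S_indep by (simp add: M.indep_vars_def)
  have Tm: "(\<lambda>x. T (f x) (g x)) \<in> borel_measurable D"
    if f: "f \<in> borel_measurable D" and g: "g \<in> borel_measurable D" for D :: "'z measure" and f g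
    unfolding T_def
  proof (rule measurable_orth_remainder[OF _ g])
    fix i show "(\<lambda>x. G (f x $ i)) \<in> borel_measurable D"
      by (intro measurable_compose[OF f] measurable_compose[OF _ Gm] borel_measurable_continuous_onI continuous_intros)
  qed

  let ?q = "1 - lambda_min_pos EZ"
  have EZ: "EZ = N.expectation (\<lambda>\<omega>. line_projector (G (s i1 \<omega>)))"
    unfolding EZ_def by (simp add: row_proj_eq_line_projector[OF B] G_def)
  \<comment> \<open>Only the law of a row matters, so the bound for the row \<open>i1\<close> holds for all.\<close>
  have step: "(\<integral>\<^sup>+\<omega>. ennreal ((norm (remove_component (G (s i \<omega>)) y))\<^sup>2) \<partial>N)
      \<le> ennreal (?q * (norm y)\<^sup>2)" if y: "y \<in> V" for i y
  proof -
    have "(\<integral>\<^sup>+\<omega>. ennreal ((norm (remove_component (G (s i \<omega>)) y))\<^sup>2) \<partial>N)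
        = (\<integral>\<^sup>+t. ennreal ((norm (remove_component (G t) y))\<^sup>2) \<partial>distr N borel (s i))"
      by (intro nn_integral_distr[symmetric]) auto
    also have "\<dots> = (\<integral>\<^sup>+t. ennreal ((norm (remove_component (G t) y))\<^sup>2) \<partial>distr N borel (s i1))"
      by (simp only: rows_identical[of i i1])
    also have "\<dots> = (\<integral>\<^sup>+\<omega>. ennreal ((norm (remove_component (G (s i1 \<omega>)) y))\<^sup>2) \<partial>N)"
      by (intro nn_integral_distr) auto
    also have "\<dots> \<le> ennreal (?q * (norm y)\<^sup>2)"
      unfolding EZ using y by (intro N.expected_norm_remove_component) (auto simp: V_def EZ)
    finally show ?thesis .
  qed
  \<comment> \<open>If the initial error vanishes, \<open>E[Z\<^sub>1]\<close> may be zero and \<open>\<lambda>\<close> the minimum of the empty set; the sign of \<open>1 - \<lambda>\<close> is unknown then.\<close>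
  show ?thesis
  proof (cases "v = 0")
    case True
    have "orth_remainder rs (0::real^'n) = 0" for rs
      by (induction rs) (simp_all add: remove_component_def)
    then have "foldr (\<lambda>i. T (S i \<omega>)) l 0 = 0" for l \<omega> by (induction l) (simp_all add: T_def)
    then have "err k = (\<lambda>_. 0)" by (simp add: fun_eq_iff err Y_def True)
    then show ?thesis by (simp add: err0 True)
  next
    case False
    have q: "0 \<le> ?q"
      unfolding EZ using N.lambda_min_pos_expected_line_projector_le_1[of "\<lambda>\<omega>. G (s i1 \<omega>)" v] vV False
      by (auto simp: V_def EZ)
    \<comment> \<open>One iteration: the step is dominated by a sweep over the rows of its sketch, which have the law of \<open>s\<close>.\<close>
    have block: "(\<integral>\<^sup>+\<omega>. ennreal ((norm (T (S j \<omega>) y))\<^sup>2) \<partial>M) \<le> ennreal (?q ^ CARD('l) * (norm y)\<^sup>2)"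
      if y: "y \<in> V" for j y
    proof -
      have Ty [measurable]: "(\<lambda>R. T R y) \<in> borel_measurable borel" by (intro Tm) auto
      have rowsm: "(\<lambda>\<omega>. \<chi> i. s i \<omega>) \<in> borel_measurable N"
      proof (rule borel_measurable_euclidean_space[THEN iffD2], rule ballI)
        fix e :: "real^'m^'l" assume "e \<in> Basis"
        then obtain i a where e: "e = axis i a" by (auto simp: Basis_vec_def)
        show "(\<lambda>\<omega>. (\<chi> i. s i \<omega>) \<bullet> e) \<in> borel_measurable N" by (simp add: e inner_axis)
      qed
      have "(\<integral>\<^sup>+\<omega>. ennreal ((norm (T (S j \<omega>) y))\<^sup>2) \<partial>M)
          = (\<integral>\<^sup>+R. ennreal ((norm (T R y))\<^sup>2) \<partial>distr M borel (S j))"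
        by (intro nn_integral_distr[symmetric]) auto
      also have "\<dots> = (\<integral>\<^sup>+\<omega>. ennreal ((norm (T (\<chi> i. s i \<omega>) y))\<^sup>2) \<partial>N)"
        unfolding S_copies by (intro nn_integral_distr rowsm) auto
      also have "\<dots> \<le> (\<integral>\<^sup>+\<omega>. ennreal ((norm (foldr (\<lambda>i. remove_component (G (s i \<omega>))) L y))\<^sup>2) \<partial>N)"
      proof (intro nn_integral_mono ennreal_leI power_mono norm_ge_zero)
        fix \<omega>
        have "foldr remove_component (map (\<lambda>i. G (s i \<omega>)) L) y = foldr (\<lambda>i. remove_component (G (s i \<omega>))) L y"
          by (simp add: foldr_map comp_def)
        then show "norm (T (\<chi> i. s i \<omega>) y) \<le> norm (foldr (\<lambda>i. remove_component (G (s i \<omega>))) L y)"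
          using norm_orth_remainder_le_sweep[of "map (\<lambda>i. G (s i \<omega>)) L" y] by (simp add: T_def)
      qed
      also have "\<dots> \<le> ennreal (?q ^ length L * (norm y)\<^sup>2)"
      proof (rule N.expected_norm_after_independent_contractions[OF rows_indep, where V = V])
        show "(\<lambda>(t, y). remove_component (G t) y) \<in> borel_measurable (borel \<Otimes>\<^sub>M borel)"
          by measurable
        show "remove_component (G t) z \<in> V" if "z \<in> V" for t z
          unfolding remove_component_def using that GV V by (intro subspace_diff subspace_scale)
      qed (use q step y L in auto)
      finally show ?thesis by (simp only: lenL)
    qed
    have Ym: "Y k \<in> borel_measurable M"
    proof -
      have "(\<lambda>\<omega>. foldr (\<lambda>i. T (S i \<omega>)) l v) \<in> borel_measurable M" for l
      proof (induction l)
        case (Cons i l)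
        then show ?case using Tm[OF Sm[of i] Cons.IH] by simp
      qed simp
      then show ?thesis by (simp add: Y_def[abs_def])
    qed
    then have errm: "err k \<in> borel_measurable M"
      unfolding err[abs_def] by measurable
    have "(\<integral>\<^sup>+\<omega>. ennreal (err k \<omega>) \<partial>M) \<le> ennreal ((?q ^ CARD('l)) ^ length (rev [0..<k]) * (norm v)\<^sup>2)"
      unfolding err Y_def
    proof (rule M.expected_norm_after_independent_contractions[OF S_indep, where V = V])
      show "case_prod T \<in> borel_measurable (borel \<Otimes>\<^sub>M borel)"
        unfolding case_prod_beta' by (intro Tm) auto
    qed (use q block vV TV in auto)
    then have bound: "(\<integral>\<^sup>+\<omega>. ennreal (err k \<omega>) \<partial>M) \<le> ennreal (?q ^ (CARD('l) * k) * (norm v)\<^sup>2)"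
      by (simp add: power_mult)
    have "integrable M (err k)"
      using errm bound by (intro integrableI_nonneg) (auto simp: err intro: le_less_trans)
    moreover have "M.expectation (err k) \<le> ?q ^ (CARD('l) * k) * (norm v)\<^sup>2"
      using q bound by (intro integral_real_bounded) auto
    ultimately show ?thesis by (simp only: err0)
  qed
qed

end
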